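(* Let $\mathcal T$ be a monoid and let $\mathcal T_1,\mathcal T_2$ be monoids containing $\mathcal T$. (i) Suppose $M_1,M_2$ are $\mathcal T$-modules. If $f_1:\mathcal T_1\to\mathcal T_2$ is a monoid homomorphism fixing $\mathcal T$ and $f_2:M_1\to M_2$ is a module homomorphism, then there is a $\mathcal T$-module homomorphism $$f_1\otimes f_2:\mathcal T_1\otimes_{\mathcal T}M_1\to\mathcal T_2\otimes_{\mathcal T}M_2$$ given by $(f_1\otimes f_2)(a\otimes w)=f_1(a)\otimes f_2(w)$. (ii) If $M$ is a $\mathcal T$-semiring and $\mathcal T_1$ is commutative, then $\mathcal T_1\otimes_{\mathcal T}M$ is a $\mathcal T_1$-semiring. (iii) Suppose $\mathcal T_1,\mathcal T_2$ are monoids containing $\mathcal T$, and $A_1,A_2$ are $\mathcal T$-semirings. If $f_1:\mathcal T_1\to\mathcal T_2$ is a monoid homomorphism and $f_2:A_1\to A_2$ is a semiring homomorphism, then there is a $\mathcal T_1$-semiring homomorphism $$f_1\otimes f_2:\mathcal T_1\otimes_{\mathcal T}A_1\to\mathcal T_2\otimes_{\mathcal T}A_2$$ given by $(f_1\otimes f_2)(a\otimes b)=f_1(a)\otimes f_2(b)$ for $a\in\mathcal T_1$, $b\in A_1$.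
   Context: All monoids are multiplicative with unit $\mathbb 1$, not necessarily commutative. A (left) $\mathcal T$-module is a commutative monoid $(M,+,0)$ with a left action of $\mathcal T$ that is unital, associative, distributive over $+$, and fixes $0$; module homomorphisms preserve $0$, $+$ and the action. A $\mathcal T$-bimodule is a commutative monoid with commuting left and right $\mathcal T$-actions of this kind. A $\mathcal T$-semiring is a $\mathcal T$-bimodule $(A,+,0)$ with a second operation $\cdot$ making $A$ a semiring (associative, distributive over $+$, with a unit, $0$ absorbing; no negation), such that $a(b_1\cdot b_2)=(ab_1)\cdot b_2$ and $(b_1\cdot b_2)a=b_1\cdot(b_2a)$ for $a\in\mathcal T$, $b_i\in A$. A semiring homomorphism of $\mathcal T$-semirings is a map preserving $0$, $+$ and the $\mathcal T$-actions, and satisfying $f(b_1\cdot b_2)=f(b_1)\cdot f(b_2)$. For a monoid $\mathcal T'\supseteq\mathcal T$ and a $\mathcal T$-module $M$, the tensor extension $\mathcal T'\otimes_{\mathcal T}M$ is the quotient of the free commutative monoid (formal finite sums) on the set $\mathcal T'\times M$ by the congruence generated by $(a',v+w)\sim(a',v)+(a',w)$, $(a'a,w)\sim(a',aw)$, and $(a',0)\sim0$, for $a'\in\mathcal T'$, $a\in\mathcal T$, $v,w\in M$. The class of $(a',w)$ is written $a'\otimes w$. It is a left $\mathcal T'$-module by $a(a'\otimes w)=(aa')\otimes w$, hence a $\mathcal T$-module by restriction. In (ii) and (iii) the multiplication on a tensor extension is the one given on simple tensors by $(a_1\otimes w_1)(a_2\otimes w_2)=a_1a_2\otimes w_1w_2$,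 and the right action of $\mathcal T'$ is $(a'\otimes w)a=a'a\otimes w$ (equal to the left action when $\mathcal T'$ is commutative). In (iii), $\mathcal T_1$ acts on $\mathcal T_2\otimes_{\mathcal T}A_2$ through $f_1$.
   Formalization: In (ii), (iii) it is assumed that b1(a b2)=a(b1 b2) for a in T, else the product on simple tensors is ill-defined; in (iii) also that f1 fixes T and that T is central in T1 and T2 (weaker than commutativity), else the map or the semiring structure is ill-defined. *)

theory Defs
  imports "HOL-Algebra.Module" "HOL-Library.Multiset"
begin

section \<open>Monoid extensions\<close>

text \<open>\<open>T'\<close> is a monoid containing the monoid \<open>T\<close>, with the same unit. One element type serves for
  a base monoid and all its extensions, so that containment is literal containment of carriers.\<close>

locale monoid_extension = T: monoid T + T': monoid T' for T :: "'t monoid" and T' :: "'t monoid" +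
  assumes carrier_subset: "carrier T \<subseteq> carrier T'"
    and one_eq: "\<one>\<^bsub>T'\<^esub> = \<one>\<^bsub>T\<^esub>"
    and mult_eq: "\<lbrakk>a \<in> carrier T; b \<in> carrier T\<rbrakk> \<Longrightarrow> a \<otimes>\<^bsub>T'\<^esub> b = a \<otimes>\<^bsub>T\<^esub> b"

definition central_in :: "'t monoid \<Rightarrow> 't monoid \<Rightarrow> bool" where
  "central_in T T' \<longleftrightarrow> (\<forall>a \<in> carrier T. \<forall>b \<in> carrier T'. a \<otimes>\<^bsub>T'\<^esub> b = b \<otimes>\<^bsub>T'\<^esub> a)"

definition unital_hom :: "'t monoid \<Rightarrow> 't monoid \<Rightarrow> ('t \<Rightarrow> 't) set" where
  "unital_hom S S' = {f \<in> hom S S'. f \<one>\<^bsub>S\<^esub> = \<one>\<^bsub>S'\<^esub>}"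

lemma central_in_if_comm:
  assumes "monoid_extension T T'" "comm_monoid T'"
  shows "central_in T T'"
proof -
  interpret monoid_extension T T' by fact
  interpret T': comm_monoid T' by fact
  show ?thesis
    unfolding central_in_def using carrier_subset T'.m_comm by (meson subsetD)
qed

section \<open>Modules, bimodules and semirings over a monoid\<close>

text \<open>The library's record \<open>module\<close> extends \<open>ring\<close>; for a bare module or bimodule its
  multiplicative fields are unconstrained.\<close>

locale act_module = T: monoid T + M: abelian_monoid M
  for T :: "'t monoid" and M :: "('t, 'b, 'm) module_scheme" +
  assumes smult_closed: "\<lbrakk>a \<in> carrier T; v \<in> carrier M\<rbrakk> \<Longrightarrow> a \<odot>\<^bsub>M\<^esub> v \<in> carrier M"
    and smult_one: "v \<in> carrier M \<Longrightarrow> \<one>\<^bsub>T\<^esub> \<odot>\<^bsub>M\<^esub> v = v"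
    and smult_assoc: "\<lbrakk>a \<in> carrier T; b \<in> carrier T; v \<in> carrier M\<rbrakk>
      \<Longrightarrow> (a \<otimes>\<^bsub>T\<^esub> b) \<odot>\<^bsub>M\<^esub> v = a \<odot>\<^bsub>M\<^esub> (b \<odot>\<^bsub>M\<^esub> v)"
    and smult_add: "\<lbrakk>a \<in> carrier T; v \<in> carrier M; w \<in> carrier M\<rbrakk>
      \<Longrightarrow> a \<odot>\<^bsub>M\<^esub> (v \<oplus>\<^bsub>M\<^esub> w) = a \<odot>\<^bsub>M\<^esub> v \<oplus>\<^bsub>M\<^esub> a \<odot>\<^bsub>M\<^esub> w"
    and smult_zero: "a \<in> carrier T \<Longrightarrow> a \<odot>\<^bsub>M\<^esub> \<zero>\<^bsub>M\<^esub> = \<zero>\<^bsub>M\<^esub>"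

locale act_module_hom = M: act_module T M + N: act_module T N
  for T :: "'t monoid" and M :: "('t, 'b, 'm) module_scheme" and N :: "('t, 'c, 'n) module_scheme" +
  fixes f :: "'b \<Rightarrow> 'c"
  assumes hom_closed: "v \<in> carrier M \<Longrightarrow> f v \<in> carrier N"
    and hom_zero: "f \<zero>\<^bsub>M\<^esub> = \<zero>\<^bsub>N\<^esub>"
    and hom_add: "\<lbrakk>v \<in> carrier M; w \<in> carrier M\<rbrakk> \<Longrightarrow> f (v \<oplus>\<^bsub>M\<^esub> w) = f v \<oplus>\<^bsub>N\<^esub> f w"
    and hom_smult: "\<lbrakk>a \<in> carrier T; v \<in> carrier M\<rbrakk> \<Longrightarrow> f (a \<odot>\<^bsub>M\<^esub> v) = a \<odot>\<^bsub>N\<^esub> f v"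

record ('t, 'b) bimodule = "('t, 'b) module" +
  rsmult :: "'b \<Rightarrow> 't \<Rightarrow> 'b"  (infixl \<open>\<odot>\<^sub>r\<index>\<close> 70)

locale act_bimodule = act_module T M
  for T :: "'t monoid" and M :: "('t, 'b, 'm) bimodule_scheme" +
  assumes rsmult_closed: "\<lbrakk>a \<in> carrier T; v \<in> carrier M\<rbrakk> \<Longrightarrow> v \<odot>\<^sub>r\<^bsub>M\<^esub> a \<in> carrier M"
    and rsmult_one: "v \<in> carrier M \<Longrightarrow> v \<odot>\<^sub>r\<^bsub>M\<^esub> \<one>\<^bsub>T\<^esub> = v"
    and rsmult_assoc: "\<lbrakk>a \<in> carrier T; b \<in> carrier T; v \<in> carrier M\<rbrakk>
      \<Longrightarrow> v \<odot>\<^sub>r\<^bsub>M\<^esub> (a \<otimes>\<^bsub>T\<^esub> b) = (v \<odot>\<^sub>r\<^bsub>M\<^esub> a) \<odot>\<^sub>r\<^bsub>M\<^esub> b"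
    and rsmult_add: "\<lbrakk>a \<in> carrier T; v \<in> carrier M; w \<in> carrier M\<rbrakk>
      \<Longrightarrow> (v \<oplus>\<^bsub>M\<^esub> w) \<odot>\<^sub>r\<^bsub>M\<^esub> a = v \<odot>\<^sub>r\<^bsub>M\<^esub> a \<oplus>\<^bsub>M\<^esub> w \<odot>\<^sub>r\<^bsub>M\<^esub> a"
    and rsmult_zero: "a \<in> carrier T \<Longrightarrow> \<zero>\<^bsub>M\<^esub> \<odot>\<^sub>r\<^bsub>M\<^esub> a = \<zero>\<^bsub>M\<^esub>"
    and smult_rsmult: "\<lbrakk>a \<in> carrier T; b \<in> carrier T; v \<in> carrier M\<rbrakk>
      \<Longrightarrow> (a \<odot>\<^bsub>M\<^esub> v) \<odot>\<^sub>r\<^bsub>M\<^esub> b = a \<odot>\<^bsub>M\<^esub> (v \<odot>\<^sub>r\<^bsub>M\<^esub> b)"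

locale act_semiring = act_bimodule T A + A: semiring A
  for T :: "'t monoid" and A :: "('t, 'b, 'm) bimodule_scheme" +
  assumes smult_mult: "\<lbrakk>a \<in> carrier T; b1 \<in> carrier A; b2 \<in> carrier A\<rbrakk>
      \<Longrightarrow> a \<odot>\<^bsub>A\<^esub> (b1 \<otimes>\<^bsub>A\<^esub> b2) = (a \<odot>\<^bsub>A\<^esub> b1) \<otimes>\<^bsub>A\<^esub> b2"
    and mult_rsmult: "\<lbrakk>a \<in> carrier T; b1 \<in> carrier A; b2 \<in> carrier A\<rbrakk>
      \<Longrightarrow> (b1 \<otimes>\<^bsub>A\<^esub> b2) \<odot>\<^sub>r\<^bsub>A\<^esub> a = b1 \<otimes>\<^bsub>A\<^esub> (b2 \<odot>\<^sub>r\<^bsub>A\<^esub> a)"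

text \<open>Preservation of the unit element is not part of the notion.\<close>

locale act_semiring_hom =
    act_module_hom T A B f + A: act_semiring T A + B: act_semiring T B
  for T :: "'t monoid" and A :: "('t, 'b, 'm) bimodule_scheme"
    and B :: "('t, 'c, 'n) bimodule_scheme" and f :: "'b \<Rightarrow> 'c" +
  assumes hom_rsmult: "\<lbrakk>a \<in> carrier T; v \<in> carrier A\<rbrakk> \<Longrightarrow> f (v \<odot>\<^sub>r\<^bsub>A\<^esub> a) = f v \<odot>\<^sub>r\<^bsub>B\<^esub> a"
    and hom_mult: "\<lbrakk>v \<in> carrier A; w \<in> carrier A\<rbrakk> \<Longrightarrow> f (v \<otimes>\<^bsub>A\<^esub> w) = f v \<otimes>\<^bsub>B\<^esub> f w"

text \<open>The left action can be pulled out of the second factor of a product. Without this the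
  multiplication on simple tensors is not well defined: take \<open>T = T'\<close> free on one generator \<open>t\<close>,
  acting on the noncommutative polynomials over the naturals in \<open>x\<close>, \<open>y\<close> by multiplication with
  \<open>x\<close> on either side. Under the usual convention that the left and right actions of a commutative
  monoid agree, the condition is automatic, as the lemma below shows.\<close>

definition central_action :: "'t monoid \<Rightarrow> ('t, 'b, 'm) bimodule_scheme \<Rightarrow> bool" where
  "central_action T A \<longleftrightarrow> (\<forall>a \<in> carrier T. \<forall>b1 \<in> carrier A. \<forall>b2 \<in> carrier A.
     b1 \<otimes>\<^bsub>A\<^esub> (a \<odot>\<^bsub>A\<^esub> b2) = a \<odot>\<^bsub>A\<^esub> (b1 \<otimes>\<^bsub>A\<^esub> b2))"

lemma central_action_if_actions_agree:
  assumes "act_semiring T A"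
    and agree: "\<And>a v. \<lbrakk>a \<in> carrier T; v \<in> carrier A\<rbrakk> \<Longrightarrow> a \<odot>\<^bsub>A\<^esub> v = v \<odot>\<^sub>r\<^bsub>A\<^esub> a"
  shows "central_action T A"
proof -
  interpret act_semiring T A by fact
  show ?thesis
    unfolding central_action_def
  proof (intro ballI)
    fix a b1 b2 assume *: "a \<in> carrier T" "b1 \<in> carrier A" "b2 \<in> carrier A"
    show "b1 \<otimes>\<^bsub>A\<^esub> (a \<odot>\<^bsub>A\<^esub> b2) = a \<odot>\<^bsub>A\<^esub> (b1 \<otimes>\<^bsub>A\<^esub> b2)"
      unfolding agree[OF *(1,3)] agree[OF *(1) A.m_closed[OF *(2,3)]]
      by (rule mult_rsmult[OF *, symmetric])
  qed
qed

definition restrict_scalars ::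
    "('s \<Rightarrow> 't) \<Rightarrow> ('t, 'b) bimodule \<Rightarrow> ('s, 'b) bimodule" where
  "restrict_scalars f N =
     \<lparr>carrier = carrier N, monoid.mult = monoid.mult N, one = one N, zero = zero N, add = add N,
      smult = (\<lambda>a v. f a \<odot>\<^bsub>N\<^esub> v), rsmult = (\<lambda>v a. v \<odot>\<^sub>r\<^bsub>N\<^esub> f a)\<rparr>"

section \<open>Tensor extension\<close>

text \<open>The free commutative monoid on a set \<open>X\<close> is the monoid of finite multisets over \<open>X\<close>.\<close>

definition formal_sums :: "'t monoid \<Rightarrow> ('t, 'b, 'm) module_scheme \<Rightarrow> ('t \<times> 'b) multiset set" where
  "formal_sums T' M = {x. set_mset x \<subseteq> carrier T' \<times> carrier M}"

inductive tensor_cong ::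
    "'t monoid \<Rightarrow> 't monoid \<Rightarrow> ('t, 'b, 'm) module_scheme \<Rightarrow>
     ('t \<times> 'b) multiset \<Rightarrow> ('t \<times> 'b) multiset \<Rightarrow> bool"
  for T T' M where
  distrib: "\<lbrakk>a' \<in> carrier T'; v \<in> carrier M; w \<in> carrier M\<rbrakk>
      \<Longrightarrow> tensor_cong T T' M {#(a', v \<oplus>\<^bsub>M\<^esub> w)#} {#(a', v), (a', w)#}"
| balance: "\<lbrakk>a' \<in> carrier T'; a \<in> carrier T; w \<in> carrier M\<rbrakk>
      \<Longrightarrow> tensor_cong T T' M {#(a' \<otimes>\<^bsub>T'\<^esub> a, w)#} {#(a', a \<odot>\<^bsub>M\<^esub> w)#}"
| zero: "a' \<in> carrier T' \<Longrightarrow> tensor_cong T T' M {#(a', \<zero>\<^bsub>M\<^esub>)#} {#}"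
| refl: "x \<in> formal_sums T' M \<Longrightarrow> tensor_cong T T' M x x"
| sym: "tensor_cong T T' M x y \<Longrightarrow> tensor_cong T T' M y x"
| trans: "\<lbrakk>tensor_cong T T' M x y; tensor_cong T T' M y z\<rbrakk> \<Longrightarrow> tensor_cong T T' M x z"
| add: "\<lbrakk>tensor_cong T T' M x y; tensor_cong T T' M u v\<rbrakk>
      \<Longrightarrow> tensor_cong T T' M (x + u) (y + v)"

definition tensor_class ::
    "'t monoid \<Rightarrow> 't monoid \<Rightarrow> ('t, 'b, 'm) module_scheme \<Rightarrow>
     ('t \<times> 'b) multiset \<Rightarrow> ('t \<times> 'b) multiset set" where
  "tensor_class T T' M x = {y. tensor_cong T T' M x y}"

definition simple_tensor ::
    "'t monoid \<Rightarrow> 't monoid \<Rightarrow> ('t, 'b, 'm) module_scheme \<Rightarrow>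
     't \<Rightarrow> 'b \<Rightarrow> ('t \<times> 'b) multiset set" where
  "simple_tensor T T' M a w = tensor_class T T' M {#(a, w)#}"

text \<open>The operations on classes are induced by those on representatives: the union over all
  representatives is a single class precisely if the operation is well defined. Where it is not
  well defined, the result lies outside the carrier, so that closedness of the operations, as
  required by the locales above, includes their well-definedness. The biadditive extension of
  the multiplication of simple tensors to formal sums is the sum over all pairs of summands.
  For a bare module
  the multiplicative fields of the result are meaningless.\<close>

definition tensor_extension ::
    "'t monoid \<Rightarrow> 't monoid \<Rightarrow> ('t, 'b, 'm) module_scheme \<Rightarrow>
     ('t, ('t \<times> 'b) multiset set) bimodule" where
  "tensor_extension T T' M =
     \<lparr>carrier = tensor_class T T' M ` formal_sums T' M,
      monoid.mult = (\<lambda>X Y. \<Union>x \<in> X. \<Union>y \<in> Y. tensor_class T T' M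
        (\<Sum>p \<in># x. {#(fst p \<otimes>\<^bsub>T'\<^esub> fst q, snd p \<otimes>\<^bsub>M\<^esub> snd q). q \<in># y#})),
      one = simple_tensor T T' M \<one>\<^bsub>T'\<^esub> \<one>\<^bsub>M\<^esub>,
      zero = tensor_class T T' M {#},
      add = (\<lambda>X Y. \<Union>x \<in> X. \<Union>y \<in> Y. tensor_class T T' M (x + y)),
      smult = (\<lambda>a X. \<Union>x \<in> X. tensor_class T T' M
        (image_mset (\<lambda>(a', w). (a \<otimes>\<^bsub>T'\<^esub> a', w)) x)),
      rsmult = (\<lambda>X a. \<Union>x \<in> X. tensor_class T T' M
        (image_mset (\<lambda>(a', w). (a' \<otimes>\<^bsub>T'\<^esub> a, w)) x))\<rparr>"

end

theory Submission
  imports Defs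
begin

text \<open>Every operation on a tensor extension is induced by a map of formal sums that is additive in
  each argument, and all algebraic laws already hold as equalities of formal sums. What remains is
  that these maps respect the congruence, which by additivity has to be checked only on its
  generators. For the multiplication it amounts to being able to move an element of \<open>T\<close> past an
  arbitrary element of \<open>T'\<close> and past an arbitrary left factor in \<open>A\<close>.\<close>

section \<open>Maps of formal sums that respect the congruence\<close>

text \<open>Since \<open>image_mset g\<close> is additive, symmetry, transitivity and sums transfer
  by themselves; only the three generating relations and reflexivity say something about
  \<open>g\<close>. Source and target may differ, so the same argument serves for the actions, for
  multiplication by a single pair, and for maps between two extensions.\<close>

lemma tensor_cong_image_mset:
  assumes "tensor_cong T T' M x y"
    and closed: "\<And>a v. \<lbrakk>a \<in> carrier T'; v \<in> carrier M\<rbrakk> \<Longrightarrow> g (a, v) \<in> carrier S' \<times> carrier N"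
    and distrib: "\<And>a v w. \<lbrakk>a \<in> carrier T'; v \<in> carrier M; w \<in> carrier M\<rbrakk>
      \<Longrightarrow> tensor_cong S S' N {#g (a, v \<oplus>\<^bsub>M\<^esub> w)#} {#g (a, v), g (a, w)#}"
    and balance: "\<And>a' a w. \<lbrakk>a' \<in> carrier T'; a \<in> carrier T; w \<in> carrier M\<rbrakk>
      \<Longrightarrow> tensor_cong S S' N {#g (a' \<otimes>\<^bsub>T'\<^esub> a, w)#} {#g (a', a \<odot>\<^bsub>M\<^esub> w)#}"
    and zero: "\<And>a. a \<in> carrier T' \<Longrightarrow> tensor_cong S S' N {#g (a, \<zero>\<^bsub>M\<^esub>)#} {#}"
  shows "tensor_cong S S' N (image_mset g x) (image_mset g y)"
  using assms(1)
proof induction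
  \<comment> \<open>Reflexivity holds only for formal sums over the carriers, hence the closure
    condition on \<open>g\<close>.\<close>
  case (refl x)
  then have "image_mset g x \<in> formal_sums S' N"
    using closed unfolding formal_sums_def by fastforce
  then show ?case by (rule tensor_cong.refl)
qed (auto intro: distrib balance zero tensor_cong.sym tensor_cong.trans tensor_cong.add)

section \<open>The product of formal sums\<close>

text \<open>Names the expression on representatives that occurs in the product of
  \<open>tensor_extension\<close>, so that its additivity in each argument can be used.\<close>

definition formal_mult ::
    "'t monoid \<Rightarrow> ('t, 'b, 'm) module_scheme \<Rightarrow>
     ('t \<times> 'b) multiset \<Rightarrow> ('t \<times> 'b) multiset \<Rightarrow> ('t \<times> 'b) multiset" where
  "formal_mult T' M x y =
     (\<Sum>p \<in># x. {#(fst p \<otimes>\<^bsub>T'\<^esub> fst q, snd p \<otimes>\<^bsub>M\<^esub> snd q). q \<in># y#})"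

lemma formal_mult_empty [simp]:
  "formal_mult T' M {#} y = {#}" "formal_mult T' M x {#} = {#}"
  by (simp_all add: formal_mult_def)

lemma formal_mult_union_left:
  "formal_mult T' M (x + y) z = formal_mult T' M x z + formal_mult T' M y z"
  by (simp add: formal_mult_def)

lemma formal_mult_union_right:
  "formal_mult T' M x (y + z) = formal_mult T' M x y + formal_mult T' M x z"
  by (simp add: formal_mult_def sum_mset.distrib)

lemma formal_mult_single_left:
  "formal_mult T' M {#p#} y = image_mset (\<lambda>q. (fst p \<otimes>\<^bsub>T'\<^esub> fst q, snd p \<otimes>\<^bsub>M\<^esub> snd q)) y"
  by (simp add: formal_mult_def)

lemma formal_mult_single_right:
  "formal_mult T' M x {#q#} = image_mset (\<lambda>p. (fst p \<otimes>\<^bsub>T'\<^esub> fst q, snd p \<otimes>\<^bsub>M\<^esub> snd q)) x"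
  by (induction x) (simp_all add: formal_mult_def)

text \<open>Serves as the step of multiset inductions. A singleton \<open>{#p#}\<close> is itself
  \<open>add_mset p {#}\<close>, so unrestricted rewriting with this equation would loop; later uses
  therefore fix the arguments or rewrite at chosen occurrences.\<close>

lemma formal_mult_add_mset_left:
  "formal_mult T' M (add_mset p x) y = formal_mult T' M {#p#} y + formal_mult T' M x y"
  by (simp add: formal_mult_def)

lemma formal_mult_add_mset_right:
  "formal_mult T' M x (add_mset q y) = formal_mult T' M x {#q#} + formal_mult T' M x y"
  using formal_mult_union_right[of T' M x "{#q#}" y] by simp

abbreviation formal_smult :: "'t monoid \<Rightarrow> 't \<Rightarrow> ('t \<times> 'b) multiset \<Rightarrow> ('t \<times> 'b) multiset" where
  "formal_smult T' a \<equiv> image_mset (\<lambda>(a', w). (a \<otimes>\<^bsub>T'\<^esub> a', w))"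

abbreviation formal_rsmult :: "'t monoid \<Rightarrow> ('t \<times> 'b) multiset \<Rightarrow> 't \<Rightarrow> ('t \<times> 'b) multiset" where
  "formal_rsmult T' x a \<equiv> image_mset (\<lambda>(a', w). (a' \<otimes>\<^bsub>T'\<^esub> a, w)) x"

section \<open>The module structure of a tensor extension\<close>

locale module_extension = monoid_extension T T' + act_module T M
  for T :: "'t monoid" and T' :: "'t monoid" and M :: "('t, 'b, 'm) module_scheme"
begin

abbreviation "FS \<equiv> formal_sums T' M"
abbreviation "cong \<equiv> tensor_cong T T' M"
abbreviation "cls \<equiv> tensor_class T T' M"
abbreviation "E \<equiv> tensor_extension T T' M"

lemma base_mem [simp, intro]: "a \<in> carrier T \<Longrightarrow> a \<in> carrier T'"
  using carrier_subset by blast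

lemma cong_formal_sums:
  assumes "cong x y"
  shows "x \<in> FS \<and> y \<in> FS"
  using assms
  by induction (auto simp: formal_sums_def smult_closed)

text \<open>The congruence is an equivalence relation on \<open>FS\<close> only. A multiset outside
  \<open>FS\<close> is congruent to nothing, so all such multisets share the empty class; membership
  is therefore assumed.\<close>

lemma cls_eq_iff: "x \<in> FS \<Longrightarrow> y \<in> FS \<Longrightarrow> cls x = cls y \<longleftrightarrow> cong x y"
  unfolding tensor_class_def
  by (metis (mono_tags, lifting) Collect_cong mem_Collect_eq tensor_cong.refl tensor_cong.sym
      tensor_cong.trans)

text \<open>Evaluates an operation defined as a union over all representatives: once its value does
  not depend on the representative, the union collapses to that value, because the class contains
  \<open>x\<close> and is not empty.\<close>

lemma UN_cls:
  assumes "x \<in> FS" and "\<And>y. cong x y \<Longrightarrow> F y = F x"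
  shows "(\<Union>y \<in> cls x. F y) = F x"
proof -
  have "x \<in> cls x" using assms(1) by (simp add: tensor_class_def tensor_cong.refl)
  with assms(2) show ?thesis unfolding tensor_class_def by blast
qed

lemma formal_sums_empty [simp]: "{#} \<in> FS"
  and formal_sums_single [simp]: "{#p#} \<in> FS \<longleftrightarrow> p \<in> carrier T' \<times> carrier M"
  and formal_sums_add_mset:
    "add_mset p x \<in> FS \<longleftrightarrow> p \<in> carrier T' \<times> carrier M \<and> x \<in> FS"
  and formal_sums_union [simp]: "x + y \<in> FS \<longleftrightarrow> x \<in> FS \<and> y \<in> FS"
  by (auto simp: formal_sums_def)

lemma formal_smult_closed [simp]:
  "a \<in> carrier T' \<Longrightarrow> x \<in> FS \<Longrightarrow> formal_smult T' a x \<in> FS"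
  by (auto simp: formal_sums_def)

lemma cong_smult:
  assumes "a \<in> carrier T'" "cong x y"
  shows "cong (formal_smult T' a x) (formal_smult T' a y)"
  using assms(2)
proof (rule tensor_cong_image_mset)
  fix a' b w assume "a' \<in> carrier T'" "b \<in> carrier T" "w \<in> carrier M"
  then show "cong {#case (a' \<otimes>\<^bsub>T'\<^esub> b, w) of (a', w) \<Rightarrow> (a \<otimes>\<^bsub>T'\<^esub> a', w)#}
      {#case (a', b \<odot>\<^bsub>M\<^esub> w) of (a', w) \<Rightarrow> (a \<otimes>\<^bsub>T'\<^esub> a', w)#}"
    \<comment> \<open>Left multiplication by \<open>a\<close> keeps \<open>b\<close> at the right
      end, so after reassociation this is the balancing relation for the first component
      \<open>a \<otimes> a'\<close>.\<close>
    using tensor_cong.balance[of "a \<otimes>\<^bsub>T'\<^esub> a'" T' b T w M] assms(1)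
    by (simp add: T'.m_assoc)
qed (use assms(1) in \<open>auto intro: tensor_cong.distrib tensor_cong.zero\<close>)

lemma carrier_extension: "carrier E = cls ` FS"
  and zero_extension: "\<zero>\<^bsub>E\<^esub> = cls {#}"
  and one_extension: "\<one>\<^bsub>E\<^esub> = cls {#(\<one>\<^bsub>T'\<^esub>, \<one>\<^bsub>M\<^esub>)#}"
  by (simp_all add: tensor_extension_def simple_tensor_def)

lemma add_extension:
  assumes "x \<in> FS" "y \<in> FS"
  shows "cls x \<oplus>\<^bsub>E\<^esub> cls y = cls (x + y)"
proof -
  have *: "cls (x' + y') = cls (x + y)" if "cong x x'" "cong y y'" for x' y'
    using that assms cong_formal_sums
    by (subst cls_eq_iff) (auto intro: tensor_cong.add tensor_cong.sym)
  have "cls x \<oplus>\<^bsub>E\<^esub> cls y = (\<Union>x' \<in> cls x. \<Union>y' \<in> cls y. cls (x' + y'))"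
    by (simp add: tensor_extension_def)
  \<comment> \<open>The inner unions are constant by \<open>*\<close>, and \<open>y\<close> itself
    is a representative, so none of them is empty.\<close>
  also have "\<dots> = (\<Union>x' \<in> cls x. cls (x + y))"
    using * assms by (fastforce simp: tensor_class_def intro: tensor_cong.refl)
  also have "\<dots> = cls (x + y)"
    by (rule UN_cls) (use assms in auto)
  finally show ?thesis .
qed

lemma smult_extension:
  assumes "a \<in> carrier T'" "x \<in> FS"
  shows "a \<odot>\<^bsub>E\<^esub> cls x = cls (formal_smult T' a x)"
proof -
  have "cls (formal_smult T' a y) = cls (formal_smult T' a x)" if "cong x y" for y
    using that assms cong_formal_sums cong_smult
    by (subst cls_eq_iff) (auto intro: tensor_cong.sym)
  then show ?thesis
    using assms UN_cls[of x "\<lambda>y. cls (formal_smult T' a y)"]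
    by (simp add: tensor_extension_def)
qed

lemma abelian_monoid_extension: "abelian_monoid E"
  by (rule abelian_monoidI)
    (auto simp: carrier_extension zero_extension add_extension ac_simps)

lemma formal_smult_one: "x \<in> FS \<Longrightarrow> formal_smult T' \<one>\<^bsub>T'\<^esub> x = x"
  by (induction x) (auto simp: formal_sums_add_mset)

lemma formal_smult_assoc:
  "\<lbrakk>a \<in> carrier T'; b \<in> carrier T'; x \<in> FS\<rbrakk>
    \<Longrightarrow> formal_smult T' (a \<otimes>\<^bsub>T'\<^esub> b) x = formal_smult T' a (formal_smult T' b x)"
  by (induction x) (auto simp: formal_sums_add_mset T'.m_assoc)

text \<open>Each carrier element is the class of a formal sum, and the evaluation lemmas turn every
  axiom into an equality of formal sums. Compatibility with addition and zero is the additivity of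
  \<open>image_mset\<close>.\<close>

lemma act_module_extension: "act_module T' E"
proof -
  interpret E: abelian_monoid E by (rule abelian_monoid_extension)
  show ?thesis
    by unfold_locales
      (auto simp: carrier_extension zero_extension add_extension smult_extension
        formal_smult_one formal_smult_assoc)
qed

lemma act_module_extension_base: "act_module T E"
proof -
  interpret E: act_module T' E by (rule act_module_extension)
  show ?thesis
    by unfold_locales
      (auto simp: E.smult_closed E.smult_add E.smult_zero E.smult_assoc
        mult_eq[symmetric] one_eq[symmetric] E.smult_one)
qed

end

section \<open>The map induced by a pair of homomorphisms\<close>

text \<open>Encoded like the operations of \<open>tensor_extension\<close>, as a union over
  representatives, which is a single class once the choice is immaterial.\<close>

definition tensor_map ::
    "'t monoid \<Rightarrow> 't monoid \<Rightarrow> ('t, 'c, 'n) module_scheme \<Rightarrow> ('t \<Rightarrow> 't) \<Rightarrow> ('b \<Rightarrow> 'c) \<Rightarrow>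
     ('t \<times> 'b) multiset set \<Rightarrow> ('t \<times> 'c) multiset set" where
  "tensor_map T T2 N f1 f2 X = (\<Union>x \<in> X. tensor_class T T2 N (image_mset (map_prod f1 f2) x))"

locale extension_hom =
  E1: module_extension T T1 M + E2: module_extension T T2 N + act_module_hom T M N f2
  for T T1 T2 :: "'t monoid" and M :: "('t, 'b, 'm) module_scheme"
    and N :: "('t, 'c, 'n) module_scheme" and f1 f2 +
  assumes unital: "f1 \<in> unital_hom T1 T2" and fixes_base: "a \<in> carrier T \<Longrightarrow> f1 a = a"
begin

lemma f1_closed [simp]: "a \<in> carrier T1 \<Longrightarrow> f1 a \<in> carrier T2"
  and f1_mult: "\<lbrakk>a \<in> carrier T1; b \<in> carrier T1\<rbrakk> \<Longrightarrow> f1 (a \<otimes>\<^bsub>T1\<^esub> b) = f1 a \<otimes>\<^bsub>T2\<^esub> f1 b"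
  using unital by (auto simp: unital_hom_def hom_def)

lemma map_closed [simp]: "x \<in> E1.FS \<Longrightarrow> image_mset (map_prod f1 f2) x \<in> E2.FS"
  by (auto simp: formal_sums_def hom_closed)

text \<open>Balancing survives because \<open>f1\<close> is multiplicative and fixes
  \<open>T\<close> while \<open>f2\<close> commutes with the action: the pair
  \<open>(f1 a' \<otimes> a, f2 w)\<close> is balanced against
  \<open>(f1 a', a \<odot> f2 w)\<close>.\<close>

lemma cong_map:
  assumes "E1.cong x y"
  shows "E2.cong (image_mset (map_prod f1 f2) x) (image_mset (map_prod f1 f2) y)"
  using assms
proof (rule tensor_cong_image_mset)
  fix a' a w assume "a' \<in> carrier T1" "a \<in> carrier T" "w \<in> carrier M"
  then show "E2.cong {#map_prod f1 f2 (a' \<otimes>\<^bsub>T1\<^esub> a, w)#} {#map_prod f1 f2 (a', a \<odot>\<^bsub>M\<^esub> w)#}"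
    by (simp add: f1_mult fixes_base hom_smult hom_closed tensor_cong.balance)
qed (auto simp: hom_closed hom_add hom_zero intro: tensor_cong.distrib tensor_cong.zero)

lemma tensor_map_cls:
  assumes "x \<in> E1.FS"
  shows "tensor_map T T2 N f1 f2 (E1.cls x) = E2.cls (image_mset (map_prod f1 f2) x)"
  unfolding tensor_map_def
  using assms
proof (rule E1.UN_cls)
  fix y assume "E1.cong x y"
  then show "E2.cls (image_mset (map_prod f1 f2) y) = E2.cls (image_mset (map_prod f1 f2) x)"
    using E1.cong_formal_sums cong_map
    by (subst E2.cls_eq_iff) (auto intro: tensor_cong.sym)
qed

lemma tensor_map_simple_tensor:
  "\<lbrakk>a \<in> carrier T1; w \<in> carrier M\<rbrakk> \<Longrightarrow>
    tensor_map T T2 N f1 f2 (simple_tensor T T1 M a w) = simple_tensor T T2 N (f1 a) (f2 w)"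
  by (simp add: simple_tensor_def tensor_map_cls)

lemma map_smult:
  "\<lbrakk>a \<in> carrier T1; x \<in> E1.FS\<rbrakk> \<Longrightarrow>
    image_mset (map_prod f1 f2) (formal_smult T1 a x)
      = formal_smult T2 (f1 a) (image_mset (map_prod f1 f2) x)"
  by (induction x) (auto simp: E1.formal_sums_add_mset f1_mult)

text \<open>The action is treated for all of \<open>T1\<close>, with \<open>f1\<close> on the target
  side. Restricted to \<open>T\<close>, which \<open>f1\<close> fixes, this gives
  \<open>T\<close>-linearity; for the semiring map it gives linearity over \<open>T1\<close> acting
  through \<open>f1\<close>.\<close>

lemma tensor_map_closed: "X \<in> carrier E1.E \<Longrightarrow> tensor_map T T2 N f1 f2 X \<in> carrier E2.E"
  and tensor_map_zero: "tensor_map T T2 N f1 f2 \<zero>\<^bsub>E1.E\<^esub> = \<zero>\<^bsub>E2.E\<^esub>"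
  and tensor_map_add: "\<lbrakk>X \<in> carrier E1.E; Y \<in> carrier E1.E\<rbrakk> \<Longrightarrow>
    tensor_map T T2 N f1 f2 (X \<oplus>\<^bsub>E1.E\<^esub> Y)
      = tensor_map T T2 N f1 f2 X \<oplus>\<^bsub>E2.E\<^esub> tensor_map T T2 N f1 f2 Y"
  and tensor_map_smult: "\<lbrakk>a \<in> carrier T1; X \<in> carrier E1.E\<rbrakk> \<Longrightarrow>
    tensor_map T T2 N f1 f2 (a \<odot>\<^bsub>E1.E\<^esub> X) = f1 a \<odot>\<^bsub>E2.E\<^esub> tensor_map T T2 N f1 f2 X"
  by (auto simp: E1.carrier_extension E2.carrier_extension E1.zero_extension E2.zero_extension
      E1.add_extension E2.add_extension E1.smult_extension E2.smult_extension
      tensor_map_cls map_smult)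

lemma act_module_hom_tensor_map: "act_module_hom T E1.E E2.E (tensor_map T T2 N f1 f2)"
proof -
  interpret X: act_module T E1.E by (rule E1.act_module_extension_base)
  interpret Y: act_module T E2.E by (rule E2.act_module_extension_base)
  show ?thesis
    by unfold_locales
      (simp_all add: tensor_map_closed tensor_map_zero tensor_map_add tensor_map_smult fixes_base)
qed

end

section \<open>The semiring structure of a tensor extension\<close>

text \<open>Centrality of \<open>T\<close> in \<open>T'\<close> makes the right action and the left
  argument of the product well defined; \<open>central_action\<close> does the same for the right
  argument of the product.\<close>

locale semiring_extension = module_extension T T' A + act_semiring T A
  for T :: "'t monoid" and T' :: "'t monoid" and A :: "('t, 'b, 'm) bimodule_scheme" +
  assumes central: "central_in T T'" and central_action: "central_action T A"
begin

text \<open>Brings a factor from \<open>T\<close> to the right end, the only place where the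
  balancing relation can move it to the module side.\<close>

lemma central_right:
  "\<lbrakk>a' \<in> carrier T'; t \<in> carrier T; a \<in> carrier T'\<rbrakk>
    \<Longrightarrow> (a' \<otimes>\<^bsub>T'\<^esub> t) \<otimes>\<^bsub>T'\<^esub> a = (a' \<otimes>\<^bsub>T'\<^esub> a) \<otimes>\<^bsub>T'\<^esub> t"
  using central unfolding central_in_def by (simp add: T'.m_assoc)

lemma formal_rsmult_closed [simp]:
  "a \<in> carrier T' \<Longrightarrow> x \<in> FS \<Longrightarrow> formal_rsmult T' x a \<in> FS"
  by (auto simp: formal_sums_def)

lemma cong_rsmult:
  assumes "a \<in> carrier T'" "cong x y"
  shows "cong (formal_rsmult T' x a) (formal_rsmult T' y a)"
  using assms(2)
proof (rule tensor_cong_image_mset)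
  fix a' b w assume "a' \<in> carrier T'" "b \<in> carrier T" "w \<in> carrier A"
  then show "cong {#case (a' \<otimes>\<^bsub>T'\<^esub> b, w) of (a', w) \<Rightarrow> (a' \<otimes>\<^bsub>T'\<^esub> a, w)#}
      {#case (a', b \<odot>\<^bsub>A\<^esub> w) of (a', w) \<Rightarrow> (a' \<otimes>\<^bsub>T'\<^esub> a, w)#}"
    using assms(1) by (simp add: central_right[of a' b a] tensor_cong.balance)
qed (use assms(1) in \<open>auto intro: tensor_cong.distrib tensor_cong.zero\<close>)

lemma rsmult_extension:
  assumes "a \<in> carrier T'" "x \<in> FS"
  shows "cls x \<odot>\<^sub>r\<^bsub>E\<^esub> a = cls (formal_rsmult T' x a)"
proof -
  have "cls (formal_rsmult T' y a) = cls (formal_rsmult T' x a)" if "cong x y" for y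
    using that assms cong_formal_sums cong_rsmult
    by (subst cls_eq_iff) (auto intro: tensor_cong.sym)
  then show ?thesis
    using assms UN_cls[of x "\<lambda>y. cls (formal_rsmult T' y a)"]
    by (simp add: tensor_extension_def)
qed

lemma formal_mult_closed [simp]: "x \<in> FS \<Longrightarrow> y \<in> FS \<Longrightarrow> formal_mult T' A x y \<in> FS"
  by (fastforce simp: formal_sums_def formal_mult_def)

text \<open>By additivity in the fixed factor \<open>z\<close> it suffices to multiply by one pair
  \<open>q\<close>, which is a map on summands. There \<open>central_right\<close> carries
  \<open>a\<close> past \<open>fst q\<close>, and balancing yields
  \<open>a \<odot> (w \<otimes> snd q)\<close>, which is
  \<open>(a \<odot> w) \<otimes> snd q\<close> by \<open>smult_mult\<close>.\<close>

lemma cong_mult_left: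
  assumes "cong x y" "z \<in> FS"
  shows "cong (formal_mult T' A x z) (formal_mult T' A y z)"
  using assms(2)
proof (induction z)
  case empty
  then show ?case by (simp add: tensor_cong.refl)
next
  case (add q z)
  then have q: "fst q \<in> carrier T'" "snd q \<in> carrier A" and z: "z \<in> FS"
    by (auto simp: formal_sums_add_mset)
  have "cong (formal_mult T' A x {#q#}) (formal_mult T' A y {#q#})"
    unfolding formal_mult_single_right using assms(1)
  proof (rule tensor_cong_image_mset)
    fix a' a w assume "a' \<in> carrier T'" "a \<in> carrier T" "w \<in> carrier A"
    then show "cong {#(fst (a' \<otimes>\<^bsub>T'\<^esub> a, w) \<otimes>\<^bsub>T'\<^esub> fst q, snd (a' \<otimes>\<^bsub>T'\<^esub> a, w) \<otimes>\<^bsub>A\<^esub> snd q)#}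
        {#(fst (a', a \<odot>\<^bsub>A\<^esub> w) \<otimes>\<^bsub>T'\<^esub> fst q, snd (a', a \<odot>\<^bsub>A\<^esub> w) \<otimes>\<^bsub>A\<^esub> snd q)#}"
      using q by (simp add: central_right[of a' a "fst q"] smult_mult[symmetric] tensor_cong.balance)
  qed (use q in \<open>auto simp: A.l_distr intro: tensor_cong.distrib tensor_cong.zero\<close>)
  with add.IH[OF z] show ?case
    by (subst (1 2) formal_mult_add_mset_right) (rule tensor_cong.add)
qed

text \<open>The same reduction to a single pair \<open>p\<close>, now on the left. In the first
  component associativity in \<open>T'\<close> suffices; the difficulty sits in the second
  one.\<close>

lemma cong_mult_right:
  assumes "cong x y" "z \<in> FS"
  shows "cong (formal_mult T' A z x) (formal_mult T' A z y)"
  using assms(2)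
proof (induction z)
  case empty
  then show ?case by (simp add: tensor_cong.refl)
next
  case (add p z)
  then have p: "fst p \<in> carrier T'" "snd p \<in> carrier A" and z: "z \<in> FS"
    by (auto simp: formal_sums_add_mset)
  have "cong (formal_mult T' A {#p#} x) (formal_mult T' A {#p#} y)"
    unfolding formal_mult_single_left using assms(1)
  proof (rule tensor_cong_image_mset)
    fix a' a w assume *: "a' \<in> carrier T'" "a \<in> carrier T" "w \<in> carrier A"
    \<comment> \<open>Balancing puts \<open>a\<close> in front of the whole product, whereas the
      relation to be preserved has it on the right factor; \<open>central_action\<close> identifies
      the two.\<close>
    moreover have "snd p \<otimes>\<^bsub>A\<^esub> (a \<odot>\<^bsub>A\<^esub> w) = a \<odot>\<^bsub>A\<^esub> (snd p \<otimes>\<^bsub>A\<^esub> w)"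
      using central_action * p unfolding central_action_def by blast
    ultimately
    show "cong {#(fst p \<otimes>\<^bsub>T'\<^esub> fst (a' \<otimes>\<^bsub>T'\<^esub> a, w), snd p \<otimes>\<^bsub>A\<^esub> snd (a' \<otimes>\<^bsub>T'\<^esub> a, w))#}
        {#(fst p \<otimes>\<^bsub>T'\<^esub> fst (a', a \<odot>\<^bsub>A\<^esub> w), snd p \<otimes>\<^bsub>A\<^esub> snd (a', a \<odot>\<^bsub>A\<^esub> w))#}"
      using p tensor_cong.balance[of "fst p \<otimes>\<^bsub>T'\<^esub> a'" T' a T "snd p \<otimes>\<^bsub>A\<^esub> w" A]
      by (simp add: T'.m_assoc)
  qed (use p in \<open>auto simp: A.r_distr intro: tensor_cong.distrib tensor_cong.zero\<close>)
  with add.IH[OF z] show ?case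
    by (subst (1 2) formal_mult_add_mset_left) (rule tensor_cong.add)
qed

lemma mult_extension:
  assumes "x \<in> FS" "y \<in> FS"
  shows "cls x \<otimes>\<^bsub>E\<^esub> cls y = cls (formal_mult T' A x y)"
proof -
  have *: "cls (formal_mult T' A x' y') = cls (formal_mult T' A x y)"
    if "cong x x'" "cong y y'" for x' y'
  proof -
    \<comment> \<open>Change one factor at a time, passing through a product of one old and one new
      representative.\<close>
    have "cong (formal_mult T' A x y) (formal_mult T' A x' y')"
      using cong_mult_left[OF that(1)] cong_mult_right[OF that(2)] that assms cong_formal_sums
      by (blast intro: tensor_cong.trans)
    with that assms cong_formal_sums show ?thesis
      by (subst cls_eq_iff) (auto intro: tensor_cong.sym)
  qed
  have "cls x \<otimes>\<^bsub>E\<^esub> cls y = (\<Union>x' \<in> cls x. \<Union>y' \<in> cls y. cls (formal_mult T' A x' y'))"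
    by (simp add: tensor_extension_def formal_mult_def)
  also have "\<dots> = (\<Union>x' \<in> cls x. cls (formal_mult T' A x y))"
    using * assms by (fastforce simp: tensor_class_def intro: tensor_cong.refl)
  also have "\<dots> = cls (formal_mult T' A x y)"
    by (rule UN_cls) (use assms in auto)
  finally show ?thesis .
qed

lemma formal_rsmult_one: "x \<in> FS \<Longrightarrow> formal_rsmult T' x \<one>\<^bsub>T'\<^esub> = x"
  by (induction x) (auto simp: formal_sums_add_mset)

lemma formal_rsmult_assoc:
  "\<lbrakk>a \<in> carrier T'; b \<in> carrier T'; x \<in> FS\<rbrakk>
    \<Longrightarrow> formal_rsmult T' x (a \<otimes>\<^bsub>T'\<^esub> b) = formal_rsmult T' (formal_rsmult T' x a) b"
  by (induction x) (auto simp: formal_sums_add_mset T'.m_assoc)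

lemma formal_smult_rsmult:
  "\<lbrakk>a \<in> carrier T'; b \<in> carrier T'; x \<in> FS\<rbrakk>
    \<Longrightarrow> formal_rsmult T' (formal_smult T' a x) b = formal_smult T' a (formal_rsmult T' x b)"
  by (induction x) (auto simp: formal_sums_add_mset T'.m_assoc)

lemma formal_mult_one_left: "x \<in> FS \<Longrightarrow> formal_mult T' A {#(\<one>\<^bsub>T'\<^esub>, \<one>\<^bsub>A\<^esub>)#} x = x"
  unfolding formal_mult_single_left by (induction x) (auto simp: formal_sums_add_mset)

lemma formal_mult_one_right: "x \<in> FS \<Longrightarrow> formal_mult T' A x {#(\<one>\<^bsub>T'\<^esub>, \<one>\<^bsub>A\<^esub>)#} = x"
  unfolding formal_mult_single_right by (induction x) (auto simp: formal_sums_add_mset)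

text \<open>The left action affects only first components, so on each pair of summands this is
  associativity in \<open>T'\<close>; the inductions on \<open>x\<close> and then \<open>y\<close>
  reduce to that case.\<close>

lemma formal_smult_mult:
  assumes "a \<in> carrier T'" "x \<in> FS" "y \<in> FS"
  shows "formal_smult T' a (formal_mult T' A x y) = formal_mult T' A (formal_smult T' a x) y"
  using assms(2)
proof (induction x)
  case (add p x)
  have "formal_smult T' a (formal_mult T' A {#p#} y)
      = formal_mult T' A {#(a \<otimes>\<^bsub>T'\<^esub> fst p, snd p)#} y"
    unfolding formal_mult_single_left using assms(1,3) add.prems
    by (induction y) (auto simp: formal_sums_add_mset T'.m_assoc)
  with add show ?case
    by (subst formal_mult_add_mset_left)
      (simp add: formal_sums_add_mset formal_mult_add_mset_left[of _ _ "(_, _)" "image_mset _ _"]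
        case_prod_unfold)
qed simp

lemma formal_mult_rsmult:
  assumes "a \<in> carrier T'" "x \<in> FS" "y \<in> FS"
  shows "formal_rsmult T' (formal_mult T' A x y) a = formal_mult T' A x (formal_rsmult T' y a)"
  using assms(3)
proof (induction y)
  case (add q y)
  have "formal_rsmult T' (formal_mult T' A x {#q#}) a
      = formal_mult T' A x {#(fst q \<otimes>\<^bsub>T'\<^esub> a, snd q)#}"
    unfolding formal_mult_single_right using assms(1,2) add.prems
    by (induction x) (auto simp: formal_sums_add_mset T'.m_assoc)
  with add show ?case
    by (subst formal_mult_add_mset_right)
      (simp add: formal_sums_add_mset formal_mult_add_mset_right[of _ _ _ "(_, _)" "image_mset _ _"]
        case_prod_unfold)
qed simp

text \<open>Three nested inductions, on \<open>x\<close>, \<open>y\<close> and \<open>z\<close>, use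
  additivity to reduce to single pairs, where the claim is associativity in \<open>T'\<close> and in
  \<open>A\<close>.\<close>

lemma formal_mult_assoc:
  assumes "x \<in> FS" "y \<in> FS" "z \<in> FS"
  shows "formal_mult T' A (formal_mult T' A x y) z = formal_mult T' A x (formal_mult T' A y z)"
  using assms(1)
proof (induction x)
  case (add p x)
  have "formal_mult T' A (formal_mult T' A {#p#} y) z
      = formal_mult T' A {#p#} (formal_mult T' A y z)"
    using assms(2)
  proof (induction y)
    case (add q y)
    have "formal_mult T' A (formal_mult T' A {#p#} {#q#}) z
        = formal_mult T' A {#p#} (formal_mult T' A {#q#} z)"
      using assms(3) add.prems \<open>add_mset p x \<in> FS\<close>
      by (induction z) (auto simp: formal_mult_single_left formal_sums_add_mset T'.m_assoc A.m_assoc)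
    with add show ?case
      by (simp add: formal_mult_add_mset_left[of _ _ q y] formal_mult_add_mset_right[of _ _ _ q y]
          formal_mult_union_left formal_mult_union_right formal_sums_add_mset)
  qed simp
  with add show ?case
    by (simp add: formal_mult_add_mset_left[of _ _ p x] formal_mult_union_left formal_sums_add_mset)
qed simp

text \<open>Evaluation on classes leaves identities of formal sums: distributivity is additivity of
  \<open>formal_mult\<close> in each argument, and zero absorbs because a product with the empty sum
  is empty.\<close>

lemma act_semiring_extension: "act_semiring T' E"
proof -
  interpret E: act_module T' E by (rule act_module_extension)
  interpret Em: monoid E
    by (rule monoidI)
      (auto simp: carrier_extension one_extension mult_extension formal_mult_assoc
        formal_mult_one_left formal_mult_one_right)
  show ?thesis
    by unfold_locales
      (auto simp: carrier_extension zero_extension add_extension mult_extension smult_extension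
        rsmult_extension formal_mult_union_left formal_mult_union_right formal_rsmult_one
        formal_rsmult_assoc formal_smult_rsmult formal_smult_mult formal_mult_rsmult)
qed

end

section \<open>Restriction of scalars along a monoid homomorphism\<close>

text \<open>Sum and product are unchanged, and each axiom for a scalar \<open>a\<close> is the old
  axiom for \<open>f a\<close>; that \<open>f\<close> preserves the unit and products gives the unit
  and associativity laws of the actions. This supplies the target of the semiring map.\<close>

lemma act_semiring_restrict_scalars:
  assumes "monoid S" "act_semiring T A" "f \<in> unital_hom S T"
  shows "act_semiring S (restrict_scalars f A)"
proof -
  interpret S: monoid S by fact
  interpret act_semiring T A by fact
  have f: "f \<one>\<^bsub>S\<^esub> = \<one>\<^bsub>T\<^esub>" "\<And>a. a \<in> carrier S \<Longrightarrow> f a \<in> carrier T"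
    "\<And>a b. \<lbrakk>a \<in> carrier S; b \<in> carrier S\<rbrakk> \<Longrightarrow> f (a \<otimes>\<^bsub>S\<^esub> b) = f a \<otimes>\<^bsub>T\<^esub> f b"
    using assms(3) by (auto simp: unital_hom_def hom_def)
  interpret R: abelian_monoid "restrict_scalars f A"
    by (rule abelian_monoidI) (simp_all add: restrict_scalars_def M.a_ac)
  interpret R: monoid "restrict_scalars f A"
    by (rule monoidI) (simp_all add: restrict_scalars_def A.m_assoc)
  show ?thesis
    by unfold_locales
      (simp_all add: restrict_scalars_def f smult_closed smult_one smult_assoc smult_add smult_zero
        rsmult_closed rsmult_one rsmult_assoc rsmult_add rsmult_zero smult_rsmult
        smult_mult mult_rsmult A.l_distr A.r_distr)
qed

section \<open>The induced map as a semiring homomorphism\<close>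

locale semiring_extension_hom =
  S1: semiring_extension T T1 A + S2: semiring_extension T T2 B +
  extension_hom T T1 T2 A B f1 f2 + act_semiring_hom T A B f2
  for T T1 T2 :: "'t monoid" and A :: "('t, 'b) bimodule"
    and B :: "('t, 'c) bimodule" and f1 f2
begin

lemma map_rsmult:
  "\<lbrakk>a \<in> carrier T1; x \<in> S1.FS\<rbrakk> \<Longrightarrow>
    image_mset (map_prod f1 f2) (formal_rsmult T1 x a)
      = formal_rsmult T2 (image_mset (map_prod f1 f2) x) (f1 a)"
  by (induction x) (auto simp: S1.formal_sums_add_mset f1_mult)

text \<open>Additivity reduces the claim to pairs of summands, where it says that \<open>f1\<close>
  and \<open>f2\<close> are multiplicative.\<close>

lemma map_mult:
  assumes "x \<in> S1.FS" "y \<in> S1.FS"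
  shows "image_mset (map_prod f1 f2) (formal_mult T1 A x y)
    = formal_mult T2 B (image_mset (map_prod f1 f2) x) (image_mset (map_prod f1 f2) y)"
  using assms(1)
proof (induction x)
  case (add p x)
  have "image_mset (map_prod f1 f2) (formal_mult T1 A {#p#} y)
      = formal_mult T2 B {#map_prod f1 f2 p#} (image_mset (map_prod f1 f2) y)"
    unfolding formal_mult_single_left using assms(2) add.prems
    by (induction y) (auto simp: S1.formal_sums_add_mset f1_mult hom_mult)
  with add show ?case
    by (simp add: formal_mult_add_mset_left[of _ _ p x] S1.formal_sums_add_mset
        formal_mult_add_mset_left[of _ _ "map_prod f1 f2 p" "image_mset _ _"])
qed simp

lemma act_semiring_hom_tensor_map:
  "act_semiring_hom T1 S1.E (restrict_scalars f1 S2.E) (tensor_map T T2 B f1 f2)"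
proof -
  interpret X: act_semiring T1 S1.E by (rule S1.act_semiring_extension)
  interpret Y: act_semiring T1 "restrict_scalars f1 S2.E"
    by (rule act_semiring_restrict_scalars[OF S1.T'.monoid_axioms S2.act_semiring_extension unital])
  show ?thesis
  proof unfold_locales
    fix X Y assume "X \<in> carrier S1.E" "Y \<in> carrier S1.E"
    then show "tensor_map T T2 B f1 f2 (X \<otimes>\<^bsub>S1.E\<^esub> Y)
      = tensor_map T T2 B f1 f2 X \<otimes>\<^bsub>restrict_scalars f1 S2.E\<^esub> tensor_map T T2 B f1 f2 Y"
      by (auto simp: restrict_scalars_def S1.carrier_extension S1.mult_extension S2.mult_extension
          tensor_map_cls map_mult)
  next
    fix a X assume "a \<in> carrier T1" "X \<in> carrier S1.E"
    then show "tensor_map T T2 B f1 f2 (X \<odot>\<^sub>r\<^bsub>S1.E\<^esub> a)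
      = tensor_map T T2 B f1 f2 X \<odot>\<^sub>r\<^bsub>restrict_scalars f1 S2.E\<^esub> a"
      by (auto simp: restrict_scalars_def S1.carrier_extension S1.rsmult_extension
          S2.rsmult_extension tensor_map_cls map_rsmult)
  qed (simp_all add: restrict_scalars_def tensor_map_closed tensor_map_zero tensor_map_add
      tensor_map_smult)
qed

end

section \<open>The three statements about tensor extensions together\<close>

theorem theorem4p24:
  fixes T T1 T2 :: "'t monoid"
  assumes ext1: "monoid_extension T T1"
    and ext2: "monoid_extension T T2"
  shows
    "(\<forall>(M1 :: ('t, 'b) module) (M2 :: ('t, 'c) module) f1 f2.
        f1 \<in> unital_hom T1 T2 \<and> (\<forall>a \<in> carrier T. f1 a = a) \<and> act_module_hom T M1 M2 f2 \<longrightarrow>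
        (\<exists>f. act_module_hom T (tensor_extension T T1 M1) (tensor_extension T T2 M2) f \<and>
             (\<forall>a \<in> carrier T1. \<forall>w \<in> carrier M1.
                f (simple_tensor T T1 M1 a w) = simple_tensor T T2 M2 (f1 a) (f2 w))))
   \<and> (\<forall>M :: ('t, 'b) bimodule.
        act_semiring T M \<and> central_action T M \<and> comm_monoid T1 \<longrightarrow>
        act_semiring T1 (tensor_extension T T1 M) \<and>
        (\<forall>a1 \<in> carrier T1. \<forall>a2 \<in> carrier T1. \<forall>w1 \<in> carrier M. \<forall>w2 \<in> carrier M.
           simple_tensor T T1 M a1 w1 \<otimes>\<^bsub>tensor_extension T T1 M\<^esub> simple_tensor T T1 M a2 w2
             = simple_tensor T T1 M (a1 \<otimes>\<^bsub>T1\<^esub> a2) (w1 \<otimes>\<^bsub>M\<^esub> w2)) \<and>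
        (\<forall>a \<in> carrier T1. \<forall>a' \<in> carrier T1. \<forall>w \<in> carrier M.
           a \<odot>\<^bsub>tensor_extension T T1 M\<^esub> simple_tensor T T1 M a' w
             = simple_tensor T T1 M (a \<otimes>\<^bsub>T1\<^esub> a') w \<and>
           simple_tensor T T1 M a' w \<odot>\<^sub>r\<^bsub>tensor_extension T T1 M\<^esub> a
             = simple_tensor T T1 M (a' \<otimes>\<^bsub>T1\<^esub> a) w))
   \<and> (\<forall>(A1 :: ('t, 'b) bimodule) (A2 :: ('t, 'c) bimodule) f1 f2.
        central_in T T1 \<and> central_in T T2 \<and> central_action T A1 \<and> central_action T A2 \<and>
        f1 \<in> unital_hom T1 T2 \<and> (\<forall>a \<in> carrier T. f1 a = a) \<and> act_semiring_hom T A1 A2 f2 \<longrightarrow>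
        (\<exists>f. act_semiring_hom T1 (tensor_extension T T1 A1)
                (restrict_scalars f1 (tensor_extension T T2 A2)) f \<and>
             (\<forall>a \<in> carrier T1. \<forall>b \<in> carrier A1.
                f (simple_tensor T T1 A1 a b) = simple_tensor T T2 A2 (f1 a) (f2 b))))"
proof (intro conjI allI impI; (elim conjE)?)
  fix M1 :: "('t, 'b) module" and M2 :: "('t, 'c) module" and f1 f2
  assume "f1 \<in> unital_hom T1 T2" "\<forall>a \<in> carrier T. f1 a = a" and "act_module_hom T M1 M2 f2"
  then interpret extension_hom T T1 T2 M1 M2 f1 f2
    using ext1 ext2
    by (simp add: extension_hom_def extension_hom_axioms_def module_extension_def
        act_module_hom_def)
  show "\<exists>f. act_module_hom T (tensor_extension T T1 M1) (tensor_extension T T2 M2) f \<and>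
      (\<forall>a \<in> carrier T1. \<forall>w \<in> carrier M1.
        f (simple_tensor T T1 M1 a w) = simple_tensor T T2 M2 (f1 a) (f2 w))"
    \<comment> \<open>The witness is \<open>tensor_map T T2 M2 f1 f2\<close>.\<close>
    using act_module_hom_tensor_map tensor_map_simple_tensor by blast
next
  fix M :: "('t, 'b) bimodule"
  assume M: "act_semiring T M" "central_action T M" and comm: "comm_monoid T1"
  interpret M: act_semiring T M by fact
  \<comment> \<open>Commutativity of \<open>T1\<close> enters only through the centrality of
    \<open>T\<close> in it.\<close>
  interpret semiring_extension T T1 M
    using ext1 M central_in_if_comm[OF ext1 comm]
    by (simp add: semiring_extension_def semiring_extension_axioms_def module_extension_def
        M.act_module_axioms)
  show "act_semiring T1 (tensor_extension T T1 M)"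
    by (rule act_semiring_extension)
  show "\<forall>a1 \<in> carrier T1. \<forall>a2 \<in> carrier T1. \<forall>w1 \<in> carrier M. \<forall>w2 \<in> carrier M.
      simple_tensor T T1 M a1 w1 \<otimes>\<^bsub>tensor_extension T T1 M\<^esub> simple_tensor T T1 M a2 w2
        = simple_tensor T T1 M (a1 \<otimes>\<^bsub>T1\<^esub> a2) (w1 \<otimes>\<^bsub>M\<^esub> w2)"
    by (simp add: simple_tensor_def mult_extension formal_mult_single_left)
  show "\<forall>a \<in> carrier T1. \<forall>a' \<in> carrier T1. \<forall>w \<in> carrier M.
      a \<odot>\<^bsub>tensor_extension T T1 M\<^esub> simple_tensor T T1 M a' w
        = simple_tensor T T1 M (a \<otimes>\<^bsub>T1\<^esub> a') w \<and>
      simple_tensor T T1 M a' w \<odot>\<^sub>r\<^bsub>tensor_extension T T1 M\<^esub> a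
        = simple_tensor T T1 M (a' \<otimes>\<^bsub>T1\<^esub> a) w"
    by (simp add: simple_tensor_def smult_extension rsmult_extension)
next
  fix A1 :: "('t, 'b) bimodule" and A2 :: "('t, 'c) bimodule" and f1 f2
  assume A: "central_in T T1" "central_in T T2" "central_action T A1" "central_action T A2"
    "f1 \<in> unital_hom T1 T2" "\<forall>a \<in> carrier T. f1 a = a"
    and "act_semiring_hom T A1 A2 f2"
  interpret h: act_semiring_hom T A1 A2 f2 by fact
  interpret semiring_extension_hom T T1 T2 A1 A2 f1 f2
    using A ext1 ext2 h.act_semiring_hom_axioms h.act_module_hom_axioms h.A.act_semiring_axioms h.B.act_semiring_axioms
      h.M.act_module_axioms h.N.act_module_axioms
    by (simp add: semiring_extension_hom_def semiring_extension_def semiring_extension_axioms_def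
        extension_hom_def extension_hom_axioms_def module_extension_def)
  show "\<exists>f. act_semiring_hom T1 (tensor_extension T T1 A1)
        (restrict_scalars f1 (tensor_extension T T2 A2)) f \<and>
      (\<forall>a \<in> carrier T1. \<forall>b \<in> carrier A1.
        f (simple_tensor T T1 A1 a b) = simple_tensor T T2 A2 (f1 a) (f2 b))"
    \<comment> \<open>The witness is \<open>tensor_map T T2 A2 f1 f2\<close>, whose formula on
      simple tensors is already known from the module case.\<close>
    using act_semiring_hom_tensor_map tensor_map_simple_tensor by blast
qed

end
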